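(* Let $\mathscr{G}$ be a non-deterministic functor, and $\mathcal{G}$ a binary relation on the set of $\mathscr{G}$-expressions. If $(\mathcal{B}_{\mathscr{G}}, \mathcal{F}_0 = \{\}, \mathcal{G}_0 = \lceil\mathcal{G}\rceil) \Rightarrow^{*} (\mathcal{B}_{\mathscr{G}}, \mathcal{F}_n, \mathcal{G}_n = \{\})$ using the rules [Reduce], [Derive] and [Simplify], then $\mathcal{G} \subseteq \sim_{\mathscr{G}}$.
   Context: Non-deterministic functors $\mathscr{G}:\mathbf{Set}\to\mathbf{Set}$ are built from $Id$, finite join-semilattice constants $\mathsf{B}$, product, the sum $X\uplus Y\uplus\{\bot,\top\}$, exponentiation by a finite alphabet $A$ and finite powerset. $\mathsf{Exp}_{\mathscr{G}}$ is the set of closed, guarded, well-typed generalized regular expressions for $\mathscr{G}$, with coalgebra structure $\delta_{\mathscr{G}\triangleleft\mathscr{G}}:\mathsf{Exp}_{\mathscr{G}}\to\mathscr{G}(\mathsf{Exp}_{\mathscr{G}})$, and $\sim_{\mathscr{G}}$ is bisimilarity. $\mathcal{E}_{\mathscr{G}}$ is the algebraic specification encoding the functor, the expressions, their typing, structured expressions and the equations defining $\delta$. $\mathcal{B}_{\mathscr{G}}$ is the CIRC theory with algebraic part $\mathcal{E}_{\mathscr{G}}$, single derivative $\delta_{\mathscr{G}\triangleleft\mathscr{G}}( *{:}\mathsf{Exp})$ (only equations of sort $\mathsf{Exp}$ are derivable), and equational interpolants: $\langle\sigma_1,\sigma_2\rangle=\langle\sigma_1',\sigma_2'\rangle \Rightarrow\{\sigma_1=\sigma_1',\sigma_2=\sigma_2'\}$;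 $k_i(\sigma)=k_i(\sigma')\Rightarrow\{\sigma=\sigma'\}$; $f=g\Rightarrow\{f(a)=g(a)\mid a\in A\}$; for sets, $\{\sigma_1..\sigma_n\}=\{\sigma_1'..\sigma_m'\}$ reduces to every $\sigma_i$ equal to some $\sigma'_j$ and every $\sigma'_j$ equal to some $\sigma_i$; and $t=t'\Rightarrow\{t\simeq t'=\mathit{true}\}$ making semilattice-sorted equations non-derivable. $\lceil\cdot\rceil$ is the freezing operator (moving terms to a fresh sort $\mathsf{Frozen}$, blocking congruence); $\lceil\mathcal{G}\rceil$ is the set of frozen equations $\lceil\varepsilon\rceil=\lceil\varepsilon'\rceil$ for pairs in $\mathcal{G}$. Entailment $\vdash$ is the extended equational entailment $\vdash_{NDF}$ (ordinary entailment plus rules decomposing frozen equalities of pairs, injections, functions and sets componentwise, plus the interpolants). CIRC reduction rules on triples (specification, hypotheses $\mathcal{F}$, goals): [Reduce] removes a goal $\lceil e\rceil$ if $\mathcal{B}\cup\mathcal{F}\vdash\lceil e\rceil$; [Derive] for a derivable goal $\lceil e\rceil$ not entailed by $\mathcal{B}\cup\mathcal{F}$ adds $\lceil e\rceil$ to the hypotheses and its frozen derivatives $\lceil\delta[e]\rceil$ to the goals; [Simplify] replaces a goal $\lceil\theta(e)\rceil$ by $\{\lceil\theta(e_i)\rceil\mid i\in I\}$ when $e\Rightarrow\{e_i\mid i\in I\}$ is an interpolant and $\theta$ a substitution. *)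

theory Defs
  imports Main "HOL-Library.FSet"
begin

section \<open>Non-deterministic functors\<close>

datatype 'b jsl = JSL (jcarrier: "'b fset") (jjoin: "'b \<Rightarrow> 'b \<Rightarrow> 'b") (jbot: 'b)

definition join_semilattice :: "'b jsl \<Rightarrow> bool" where
  "join_semilattice B \<longleftrightarrow>
     jbot B |\<in>| jcarrier B \<and>
     (\<forall>x y. x |\<in>| jcarrier B \<longrightarrow> y |\<in>| jcarrier B \<longrightarrow>
        jjoin B x y |\<in>| jcarrier B \<and> jjoin B x y = jjoin B y x) \<and>
     (\<forall>x y z. x |\<in>| jcarrier B \<longrightarrow> y |\<in>| jcarrier B \<longrightarrow> z |\<in>| jcarrier B \<longrightarrow>
        jjoin B (jjoin B x y) z = jjoin B x (jjoin B y z)) \<and>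
     (\<forall>x. x |\<in>| jcarrier B \<longrightarrow> jjoin B x x = x \<and> jjoin B (jbot B) x = x)"

text \<open>
  Raw functor expressions. \<open>FSum\<close> is the sum \<open>X \<uplus> Y \<uplus> {\<bottom>, \<top>}\<close>; \<open>FExp F A\<close> is \<open>F\<close> to the
  power of the finite alphabet \<open>A\<close>. Different constants and alphabets may occur in one functor.
\<close>

datatype ('a, 'b) ndf =
    FId
  | FConst "'b jsl"
  | FProd "('a, 'b) ndf" "('a, 'b) ndf"
  | FSum "('a, 'b) ndf" "('a, 'b) ndf"
  | FExp "('a, 'b) ndf" "'a fset"
  | FPow "('a, 'b) ndf"

primrec nondet_functor :: "('a, 'b) ndf \<Rightarrow> bool" where
  "nondet_functor FId \<longleftrightarrow> True"
| "nondet_functor (FConst B) \<longleftrightarrow> join_semilattice B"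
| "nondet_functor (FProd F1 F2) \<longleftrightarrow> nondet_functor F1 \<and> nondet_functor F2"
| "nondet_functor (FSum F1 F2) \<longleftrightarrow> nondet_functor F1 \<and> nondet_functor F2"
| "nondet_functor (FExp F A) \<longleftrightarrow> nondet_functor F"
| "nondet_functor (FPow F) \<longleftrightarrow> nondet_functor F"

text \<open>\<open>ingredient F G\<close> is the relation \<open>F \<triangleleft> G\<close>.\<close>

inductive ingredient :: "('a, 'b) ndf \<Rightarrow> ('a, 'b) ndf \<Rightarrow> bool" where
  ing_refl: "ingredient F F"
| ing_trans: "ingredient F F' \<Longrightarrow> ingredient F' F'' \<Longrightarrow> ingredient F F''"
| ing_prod1: "ingredient F1 (FProd F1 F2)"
| ing_prod2: "ingredient F2 (FProd F1 F2)"
| ing_sum1: "ingredient F1 (FSum F1 F2)"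
| ing_sum2: "ingredient F2 (FSum F1 F2)"
| ing_exp: "ingredient F (FExp F A)"
| ing_pow: "ingredient F (FPow F)"

text \<open>
  Elements of the sets \<open>F X\<close>. A function out of an alphabet \<open>A\<close> is a partial map with domain \<open>A\<close>.
  The functor action on a function \<open>h\<close> is the map function \<open>map_val h\<close> of the datatype.
\<close>

datatype (dead 'a, dead 'b, 'e) val =
    VId 'e
  | VSlt 'b
  | VPair "('a, 'b, 'e) val" "('a, 'b, 'e) val"
  | VK1 "('a, 'b, 'e) val"
  | VK2 "('a, 'b, 'e) val"
  | VBot
  | VTop
  | VFun "'a \<Rightarrow> ('a, 'b, 'e) val option"
  | VSet "('a, 'b, 'e) val fset"

primrec functor_obj :: "('a, 'b) ndf \<Rightarrow> 'e set \<Rightarrow> ('a, 'b, 'e) val set" where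
  "functor_obj FId X = VId ` X"
| "functor_obj (FConst B) X = VSlt ` fset (jcarrier B)"
| "functor_obj (FProd F1 F2) X = {VPair u v | u v. u \<in> functor_obj F1 X \<and> v \<in> functor_obj F2 X}"
| "functor_obj (FSum F1 F2) X = VK1 ` functor_obj F1 X \<union> VK2 ` functor_obj F2 X \<union> {VBot, VTop}"
| "functor_obj (FExp F A) X = {VFun f | f. dom f = fset A \<and> ran f \<subseteq> functor_obj F X}"
| "functor_obj (FPow F) X = {VSet S | S. fset S \<subseteq> functor_obj F X}"

text \<open>The relation lifting of \<open>R\<close>: pairs \<open>(G \<pi>\<^sub>1 z, G \<pi>\<^sub>2 z)\<close> for \<open>z \<in> G R\<close>.\<close>

definition rel_lifting ::
    "('a, 'b) ndf \<Rightarrow> ('e \<times> 'e) set \<Rightarrow> (('a, 'b, 'e) val \<times> ('a, 'b, 'e) val) set" where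
  "rel_lifting G R = (\<lambda>z. (map_val fst z, map_val snd z)) ` functor_obj G R"


section \<open>Generalized regular expressions\<close>

datatype ('a, 'b, 'x) expr =
    EZero
  | EVar 'x
  | EPlus "('a, 'b, 'x) expr" "('a, 'b, 'x) expr"
  | EMu 'x "('a, 'b, 'x) expr"
  | ESlt 'b
  | EProdL "('a, 'b, 'x) expr"
  | EProdR "('a, 'b, 'x) expr"
  | ESumL "('a, 'b, 'x) expr"
  | ESumR "('a, 'b, 'x) expr"
  | EAct 'a "('a, 'b, 'x) expr"
  | ESing "('a, 'b, 'x) expr"

primrec fv :: "('a, 'b, 'x) expr \<Rightarrow> 'x set" where
  "fv EZero = {}"
| "fv (EVar x) = {x}"
| "fv (EPlus e d) = fv e \<union> fv d"
| "fv (EMu x e) = fv e - {x}"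
| "fv (ESlt b) = {}"
| "fv (EProdL e) = fv e"
| "fv (EProdR e) = fv e"
| "fv (ESumL e) = fv e"
| "fv (ESumR e) = fv e"
| "fv (EAct a e) = fv e"
| "fv (ESing e) = fv e"

text \<open>
  \<open>subst x d e\<close> is \<open>e[d/x]\<close>. It is only used for closed \<open>d\<close>, so no variable can be captured.
\<close>

primrec subst :: "'x \<Rightarrow> ('a, 'b, 'x) expr \<Rightarrow> ('a, 'b, 'x) expr \<Rightarrow> ('a, 'b, 'x) expr" where
  "subst x d EZero = EZero"
| "subst x d (EVar y) = (if y = x then d else EVar y)"
| "subst x d (EPlus e1 e2) = EPlus (subst x d e1) (subst x d e2)"
| "subst x d (EMu y e) = EMu y (if y = x then e else subst x d e)"
| "subst x d (ESlt b) = ESlt b"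
| "subst x d (EProdL e) = EProdL (subst x d e)"
| "subst x d (EProdR e) = EProdR (subst x d e)"
| "subst x d (ESumL e) = ESumL (subst x d e)"
| "subst x d (ESumR e) = ESumR (subst x d e)"
| "subst x d (EAct a e) = EAct a (subst x d e)"
| "subst x d (ESing e) = ESing (subst x d e)"

text \<open>
  Guardedness is the restriction of the bodies of \<open>\<mu>\<close> to the grammar
  \<open>\<gamma> ::= \<emptyset> | \<gamma> \<oplus> \<gamma> | \<mu>x.\<gamma> | b | l\<langle>\<epsilon>\<rangle> | r\<langle>\<epsilon>\<rangle> | l[\<epsilon>] | r[\<epsilon>] | a(\<epsilon>) | {\<epsilon>}\<close>;
  \<open>gamma_shape\<close> is its outer layer.
\<close>

primrec gamma_shape :: "('a, 'b, 'x) expr \<Rightarrow> bool" where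
  "gamma_shape EZero \<longleftrightarrow> True"
| "gamma_shape (EVar x) \<longleftrightarrow> False"
| "gamma_shape (EPlus e d) \<longleftrightarrow> gamma_shape e \<and> gamma_shape d"
| "gamma_shape (EMu x e) \<longleftrightarrow> gamma_shape e"
| "gamma_shape (ESlt b) \<longleftrightarrow> True"
| "gamma_shape (EProdL e) \<longleftrightarrow> True"
| "gamma_shape (EProdR e) \<longleftrightarrow> True"
| "gamma_shape (ESumL e) \<longleftrightarrow> True"
| "gamma_shape (ESumR e) \<longleftrightarrow> True"
| "gamma_shape (EAct a e) \<longleftrightarrow> True"
| "gamma_shape (ESing e) \<longleftrightarrow> True"

primrec guarded :: "('a, 'b, 'x) expr \<Rightarrow> bool" where
  "guarded EZero \<longleftrightarrow> True"
| "guarded (EVar x) \<longleftrightarrow> True"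
| "guarded (EPlus e d) \<longleftrightarrow> guarded e \<and> guarded d"
| "guarded (EMu x e) \<longleftrightarrow> gamma_shape e \<and> guarded e"
| "guarded (ESlt b) \<longleftrightarrow> True"
| "guarded (EProdL e) \<longleftrightarrow> guarded e"
| "guarded (EProdR e) \<longleftrightarrow> guarded e"
| "guarded (ESumL e) \<longleftrightarrow> guarded e"
| "guarded (ESumR e) \<longleftrightarrow> guarded e"
| "guarded (EAct a e) \<longleftrightarrow> guarded e"
| "guarded (ESing e) \<longleftrightarrow> guarded e"

text \<open>
  \<open>has_type G e F\<close> is the typing judgement \<open>\<turnstile> e : F \<triangleleft> G\<close>, which presupposes that \<open>F\<close> is an
  ingredient of \<open>G\<close>.
\<close>

inductive has_type :: "('a, 'b) ndf \<Rightarrow> ('a, 'b, 'x) expr \<Rightarrow> ('a, 'b) ndf \<Rightarrow> bool"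
  for G :: "('a, 'b) ndf" where
  ty_zero: "ingredient F G \<Longrightarrow> has_type G EZero F"
| ty_var: "has_type G (EVar x) G"
| ty_plus: "has_type G e F \<Longrightarrow> has_type G d F \<Longrightarrow> has_type G (EPlus e d) F"
| ty_mu: "has_type G e G \<Longrightarrow> has_type G (EMu x e) G"
| ty_slt: "ingredient (FConst B) G \<Longrightarrow> b |\<in>| jcarrier B \<Longrightarrow> has_type G (ESlt b) (FConst B)"
| ty_id: "ingredient FId G \<Longrightarrow> has_type G e G \<Longrightarrow> has_type G e FId"
| ty_prodL: "ingredient (FProd F1 F2) G \<Longrightarrow> has_type G e F1 \<Longrightarrow> has_type G (EProdL e) (FProd F1 F2)"
| ty_prodR: "ingredient (FProd F1 F2) G \<Longrightarrow> has_type G e F2 \<Longrightarrow> has_type G (EProdR e) (FProd F1 F2)"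
| ty_sumL: "ingredient (FSum F1 F2) G \<Longrightarrow> has_type G e F1 \<Longrightarrow> has_type G (ESumL e) (FSum F1 F2)"
| ty_sumR: "ingredient (FSum F1 F2) G \<Longrightarrow> has_type G e F2 \<Longrightarrow> has_type G (ESumR e) (FSum F1 F2)"
| ty_act: "ingredient (FExp F A) G \<Longrightarrow> a |\<in>| A \<Longrightarrow> has_type G e F \<Longrightarrow> has_type G (EAct a e) (FExp F A)"
| ty_sing: "ingredient (FPow F) G \<Longrightarrow> has_type G e F \<Longrightarrow> has_type G (ESing e) (FPow F)"

text \<open>\<open>Exps G F\<close> is \<open>Exp\<^bsub>F \<triangleleft> G\<^esub>\<close>, and \<open>Exps G G\<close> is \<open>Exp\<^bsub>G\<^esub>\<close>.\<close>

definition Exps :: "('a, 'b) ndf \<Rightarrow> ('a, 'b) ndf \<Rightarrow> ('a, 'b, 'x) expr set" where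
  "Exps G F = {e. fv e = {} \<and> guarded e \<and> has_type G e F}"


section \<open>The coalgebra of expressions and bisimilarity\<close>

type_synonym ('a, 'b, 'x) eval = "('a, 'b, ('a, 'b, 'x) expr) val"

primrec empty_val :: "('a, 'b) ndf \<Rightarrow> ('a, 'b, 'x) eval" where
  "empty_val FId = VId EZero"
| "empty_val (FConst B) = VSlt (jbot B)"
| "empty_val (FProd F1 F2) = VPair (empty_val F1) (empty_val F2)"
| "empty_val (FSum F1 F2) = VBot"
| "empty_val (FExp F A) = VFun (\<lambda>a. if a |\<in>| A then Some (empty_val F) else None)"
| "empty_val (FPow F) = VSet {||}"

text \<open>The value \<open>undefined\<close> is only taken on arguments outside \<open>F (Exp\<^bsub>G\<^esub>)\<close>.\<close>

primrec plus_val ::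
    "('a, 'b) ndf \<Rightarrow> ('a, 'b, 'x) eval \<Rightarrow> ('a, 'b, 'x) eval \<Rightarrow> ('a, 'b, 'x) eval" where
  "plus_val FId = (\<lambda>u v. case u of
     VId e \<Rightarrow> (case v of VId d \<Rightarrow> VId (EPlus e d) | _ \<Rightarrow> undefined) | _ \<Rightarrow> undefined)"
| "plus_val (FConst B) = (\<lambda>u v. case u of
     VSlt b \<Rightarrow> (case v of VSlt c \<Rightarrow> VSlt (jjoin B b c) | _ \<Rightarrow> undefined) | _ \<Rightarrow> undefined)"
| "plus_val (FProd F1 F2) = (\<lambda>u v. case u of
     VPair u1 u2 \<Rightarrow>
       (case v of VPair v1 v2 \<Rightarrow> VPair (plus_val F1 u1 v1) (plus_val F2 u2 v2) | _ \<Rightarrow> undefined)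
   | _ \<Rightarrow> undefined)"
| "plus_val (FSum F1 F2) = (\<lambda>u v.
     if u = VTop \<or> v = VTop then VTop
     else if u = VBot then v
     else if v = VBot then u
     else case u of
       VK1 u' \<Rightarrow>
         (case v of VK1 v' \<Rightarrow> VK1 (plus_val F1 u' v') | VK2 v' \<Rightarrow> VTop | _ \<Rightarrow> undefined)
     | VK2 u' \<Rightarrow>
         (case v of VK1 v' \<Rightarrow> VTop | VK2 v' \<Rightarrow> VK2 (plus_val F2 u' v') | _ \<Rightarrow> undefined)
     | _ \<Rightarrow> undefined)"
| "plus_val (FExp F A) = (\<lambda>u v. case u of
     VFun f \<Rightarrow> (case v of
       VFun g \<Rightarrow>
         VFun (\<lambda>a. if a |\<in>| A then Some (plus_val F (the (f a)) (the (g a))) else None)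
     | _ \<Rightarrow> undefined) | _ \<Rightarrow> undefined)"
| "plus_val (FPow F) = (\<lambda>u v. case u of
     VSet S \<Rightarrow> (case v of VSet T \<Rightarrow> VSet (S |\<union>| T) | _ \<Rightarrow> undefined) | _ \<Rightarrow> undefined)"

text \<open>
  \<open>unguarded_depth\<close> is the measure \<open>N\<close> that bounds the number of unfoldings of \<open>\<mu>\<close>.
\<close>

fun unguarded_depth :: "('a, 'b, 'x) expr \<Rightarrow> nat" where
  "unguarded_depth (EPlus e d) = 1 + max (unguarded_depth e) (unguarded_depth d)"
| "unguarded_depth (EMu x e) = 1 + unguarded_depth e"
| "unguarded_depth _ = 0"

lemma unguarded_depth_subst:
  "gamma_shape e \<Longrightarrow> unguarded_depth (subst x d e) = unguarded_depth e"
  by (induction e) auto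

text \<open>
  \<open>delta G F\<close> is \<open>\<delta>\<^bsub>F \<triangleleft> G\<^esub>\<close>, a function from \<open>Exps G F\<close> to \<open>functor_obj F (Exps G G)\<close> (see
  \<open>delta_in_functor_obj\<close> below). The test of \<open>gamma_shape\<close>, which succeeds on guarded expressions,
  makes the recursion terminate on all arguments.
\<close>

function delta :: "('a, 'b) ndf \<Rightarrow> ('a, 'b) ndf \<Rightarrow> ('a, 'b, 'x) expr \<Rightarrow> ('a, 'b, 'x) eval" where
  "delta G F \<epsilon> =
     (if F = FId \<and> G \<noteq> FId then VId \<epsilon>
      else case \<epsilon> of
        EZero \<Rightarrow> empty_val F
      | EVar x \<Rightarrow> undefined
      | EPlus e d \<Rightarrow> plus_val F (delta G F e) (delta G F d)
      | EMu x e \<Rightarrow> if gamma_shape e then delta G F (subst x (EMu x e) e) else undefined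
      | ESlt b \<Rightarrow> (case F of FConst B \<Rightarrow> VSlt b | _ \<Rightarrow> undefined)
      | EProdL e \<Rightarrow> (case F of FProd F1 F2 \<Rightarrow> VPair (delta G F1 e) (empty_val F2) | _ \<Rightarrow> undefined)
      | EProdR e \<Rightarrow> (case F of FProd F1 F2 \<Rightarrow> VPair (empty_val F1) (delta G F2 e) | _ \<Rightarrow> undefined)
      | ESumL e \<Rightarrow> (case F of FSum F1 F2 \<Rightarrow> VK1 (delta G F1 e) | _ \<Rightarrow> undefined)
      | ESumR e \<Rightarrow> (case F of FSum F1 F2 \<Rightarrow> VK2 (delta G F2 e) | _ \<Rightarrow> undefined)
      | EAct a e \<Rightarrow> (case F of FExp F1 A \<Rightarrow>
            VFun (\<lambda>a'. if a' |\<in>| A then Some (if a' = a then delta G F1 e else empty_val F1) else None)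
          | _ \<Rightarrow> undefined)
      | ESing e \<Rightarrow> (case F of FPow F1 \<Rightarrow> VSet {|delta G F1 e|} | _ \<Rightarrow> undefined))"
  by pat_completeness auto
termination
  by (relation "measures [\<lambda>(G, F, \<epsilon>). size F, \<lambda>(G, F, \<epsilon>). unguarded_depth \<epsilon>]")
     (auto simp: unguarded_depth_subst less_Suc_eq_le)

declare delta.simps [simp del]

definition is_bisimulation ::
    "('a, 'b) ndf \<Rightarrow> (('a, 'b, 'x) expr \<times> ('a, 'b, 'x) expr) set \<Rightarrow> bool" where
  "is_bisimulation G R \<longleftrightarrow>
     R \<subseteq> Exps G G \<times> Exps G G \<and>
     (\<forall>(e, d) \<in> R. (delta G G e, delta G G d) \<in> rel_lifting G R)"

definition bisimilarity ::
    "('a, 'b) ndf \<Rightarrow> (('a, 'b, 'x) expr \<times> ('a, 'b, 'x) expr) set" where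
  "bisimilarity G = \<Union> {R. is_bisimulation G R}"

lemma has_type_ingredient: "has_type G e F \<Longrightarrow> ingredient F G"
  by (induction rule: has_type.induct) (auto intro: ing_refl)

lemma nondet_functor_ingredient: "ingredient F G \<Longrightarrow> nondet_functor G \<Longrightarrow> nondet_functor F"
  by (induction rule: ingredient.induct) auto

lemma gamma_shape_subst: "gamma_shape e \<Longrightarrow> gamma_shape (subst x d e)"
  by (induction e) auto

lemma guarded_subst: "guarded e \<Longrightarrow> guarded d \<Longrightarrow> guarded (subst x d e)"
  by (induction e) (auto simp: gamma_shape_subst)

lemma fv_subst: "fv d = {} \<Longrightarrow> fv (subst x d e) = fv e - {x}"
  by (induction e) auto

lemma has_type_subst: "has_type G e F \<Longrightarrow> has_type G d G \<Longrightarrow> has_type G (subst x d e) F"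
  by (induction rule: has_type.induct) (auto intro: has_type.intros)

lemma has_type_EPlus:
  "has_type G (EPlus e d) F \<Longrightarrow> has_type G e F \<and> has_type G d F"
  by (induction "EPlus e d" F rule: has_type.induct) (auto intro: has_type.intros)

lemma has_type_EMu: "has_type G (EMu x e) F \<Longrightarrow> has_type G e G \<and> (F = G \<or> F = FId)"
  by (induction "EMu x e" F rule: has_type.induct) auto

lemma has_type_ESlt:
  "has_type G (ESlt b :: ('a, 'b, 'x) expr) F \<Longrightarrow> F = FId \<and> G \<noteq> FId \<or> (\<exists>B. F = FConst B \<and> b |\<in>| jcarrier B)"
  by (induction "ESlt b :: ('a, 'b, 'x) expr" F rule: has_type.induct) auto

lemma has_type_EProdL:
  "has_type G (EProdL e) F \<Longrightarrow>
    F = FId \<and> G \<noteq> FId \<or> (\<exists>F1 F2. F = FProd F1 F2 \<and> has_type G e F1)"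
  by (induction "EProdL e" F rule: has_type.induct) auto

lemma has_type_EProdR:
  "has_type G (EProdR e) F \<Longrightarrow>
    F = FId \<and> G \<noteq> FId \<or> (\<exists>F1 F2. F = FProd F1 F2 \<and> has_type G e F2)"
  by (induction "EProdR e" F rule: has_type.induct) auto

lemma has_type_ESumL:
  "has_type G (ESumL e) F \<Longrightarrow>
    F = FId \<and> G \<noteq> FId \<or> (\<exists>F1 F2. F = FSum F1 F2 \<and> has_type G e F1)"
  by (induction "ESumL e" F rule: has_type.induct) auto

lemma has_type_ESumR:
  "has_type G (ESumR e) F \<Longrightarrow>
    F = FId \<and> G \<noteq> FId \<or> (\<exists>F1 F2. F = FSum F1 F2 \<and> has_type G e F2)"
  by (induction "ESumR e" F rule: has_type.induct) auto

lemma has_type_EAct: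
  "has_type G (EAct a e) F \<Longrightarrow>
    F = FId \<and> G \<noteq> FId \<or> (\<exists>F1 A. F = FExp F1 A \<and> a |\<in>| A \<and> has_type G e F1)"
  by (induction "EAct a e" F rule: has_type.induct) auto

lemma has_type_ESing:
  "has_type G (ESing e) F \<Longrightarrow> F = FId \<and> G \<noteq> FId \<or> (\<exists>F1. F = FPow F1 \<and> has_type G e F1)"
  by (induction "ESing e" F rule: has_type.induct) auto

lemma Exps_EMu_unfold: "EMu x e \<in> Exps G F \<Longrightarrow> subst x (EMu x e) e \<in> Exps G G"
  unfolding Exps_def
  by (auto simp: fv_subst guarded_subst dest!: has_type_EMu intro: has_type_subst ty_mu)

lemma Exps_FId: "e \<in> Exps G FId \<Longrightarrow> e \<in> Exps G G"
proof -
  have "has_type G e F \<Longrightarrow> F = FId \<Longrightarrow> has_type G e G" for F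
    by (induction rule: has_type.induct) (auto intro: has_type.intros ing_refl)
  then show "e \<in> Exps G FId \<Longrightarrow> e \<in> Exps G G"
    by (auto simp: Exps_def)
qed

lemma empty_val_in:
  "nondet_functor F \<Longrightarrow> empty_val F \<in> functor_obj F (Exps G G)"
  by (induction F)
     (auto simp: join_semilattice_def Exps_def ran_def dom_def intro!: imageI ty_zero ing_refl)

lemma plus_val_in:
  "nondet_functor F \<Longrightarrow> u \<in> functor_obj F (Exps G G) \<Longrightarrow> v \<in> functor_obj F (Exps G G) \<Longrightarrow>
    plus_val F u v \<in> functor_obj F (Exps G G)"
proof (induction F arbitrary: u v)
  case (FExp F A)
  then obtain f g where fg: "u = VFun f" "v = VFun g" "dom f = fset A" "dom g = fset A"
    "ran f \<subseteq> functor_obj F (Exps G G)" "ran g \<subseteq> functor_obj F (Exps G G)" by auto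
  have "plus_val F (the (f a)) (the (g a)) \<in> functor_obj F (Exps G G)" if a: "a |\<in>| A" for a
  proof -
    obtain s t where "f a = Some s" "g a = Some t" using fg a by blast
    then show ?thesis using fg FExp by (auto simp: ranI subset_iff)
  qed
  then show ?case using fg by (auto simp: ran_def dom_def)
next
  case FId
  then show ?case by (auto simp: Exps_def intro: ty_plus)
next
  case (FSum F1 F2)
  then show ?case by (auto split: if_splits)
qed (auto simp: join_semilattice_def)

lemma delta_in_functor_obj:
  "nondet_functor G \<Longrightarrow> e \<in> Exps G F \<Longrightarrow> delta G F e \<in> functor_obj F (Exps G G)"
proof (induction G F e rule: delta.induct)
  case (1 G F e)
  note prems = "1.prems"
  have F: "nondet_functor F"
    using prems has_type_ingredient nondet_functor_ingredient by (fastforce simp: Exps_def)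
  show ?case
  proof (cases "F = FId \<and> G \<noteq> FId")
    case True
    then show ?thesis using prems by (auto simp: delta.simps intro: Exps_FId)
  next
    case ne: False
    show ?thesis
    proof (cases e)
      case EZero
      then show ?thesis using F ne by (subst delta.simps) (auto intro: empty_val_in)
    next
      case (EVar x)
      then show ?thesis using prems by (simp add: Exps_def)
    next
      case e: (EPlus e1 e2)
      then have "e1 \<in> Exps G F" "e2 \<in> Exps G F"
        using prems by (auto simp: Exps_def dest: has_type_EPlus)
      then show ?thesis
        using 1(1)[OF ne e] 1(2)[OF ne e] prems e F ne by (subst delta.simps) (auto intro: plus_val_in)
    next
      case e: (EMu x d)
      then have "F = G" "gamma_shape d" using prems ne by (auto simp: Exps_def dest: has_type_EMu)
      then show ?thesis
        using 1(3)[OF ne e] prems e ne by (subst delta.simps) (auto dest: Exps_EMu_unfold)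
    next
      case e: (ESlt b)
      then show ?thesis using prems ne
        by (subst delta.simps) (auto simp: Exps_def dest!: has_type_ESlt)
    next
      case e: (EProdL d)
      then obtain F1 F2 where F': "F = FProd F1 F2" "d \<in> Exps G F1"
        using prems ne by (auto simp: Exps_def dest!: has_type_EProdL)
      then show ?thesis
        using 1(4)[OF ne e F'(1)] prems e F by (subst delta.simps) (auto intro: empty_val_in)
    next
      case e: (EProdR d)
      then obtain F1 F2 where F': "F = FProd F1 F2" "d \<in> Exps G F2"
        using prems ne by (auto simp: Exps_def dest!: has_type_EProdR)
      then show ?thesis
        using 1(5)[OF ne e F'(1)] prems e F by (subst delta.simps) (auto intro: empty_val_in)
    next
      case e: (ESumL d)
      then obtain F1 F2 where F': "F = FSum F1 F2" "d \<in> Exps G F1"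
        using prems ne by (auto simp: Exps_def dest!: has_type_ESumL)
      then show ?thesis
        using 1(6)[OF ne e F'(1)] prems e by (subst delta.simps) auto
    next
      case e: (ESumR d)
      then obtain F1 F2 where F': "F = FSum F1 F2" "d \<in> Exps G F2"
        using prems ne by (auto simp: Exps_def dest!: has_type_ESumR)
      then show ?thesis
        using 1(7)[OF ne e F'(1)] prems e by (subst delta.simps) auto
    next
      case e: (EAct a d)
      then obtain F1 A where F': "F = FExp F1 A" "d \<in> Exps G F1"
        using prems ne by (auto simp: Exps_def dest!: has_type_EAct)
      have "delta G F1 d \<in> functor_obj F1 (Exps G G)" if "a |\<in>| A"
        using 1(8)[OF ne e F'(1) that] prems F'(2) that by auto
      then show ?thesis
        using e F F' by (subst delta.simps) (auto simp: ran_def dom_def intro: empty_val_in)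
    next
      case e: (ESing d)
      then obtain F1 where F': "F = FPow F1" "d \<in> Exps G F1"
        using prems ne by (auto simp: Exps_def dest!: has_type_ESing)
      then show ?thesis
        using 1(9)[OF ne e F'(1)] prems e by (subst delta.simps) auto
    qed
  qed
qed


section \<open>The algebraic specification\<close>

text \<open>
  Ground terms of sort \<open>ExpStruct\<close>, which contains the sorts of expressions (through \<open>TExp\<close>) and of
  semilattice elements (through \<open>TSlt\<close>). \<open>TDelta F e\<close>, \<open>TEmpty F\<close> and \<open>TPlus F s t\<close> are the
  operators \<open>\<delta>\<^bsub>F \<triangleleft> G\<^esub>(e)\<close>, \<open>Empty\<^bsub>F \<triangleleft> G\<^esub>\<close> and \<open>Plus\<^bsub>F \<triangleleft> G\<^esub>(s, t)\<close>; the functor \<open>G\<close> is a parameter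
  of the specification. An enumerated set \<open>{\<sigma>\<^sub>1, \<dots>, \<sigma>\<^sub>n}\<close> is a finite set of terms.
\<close>

datatype ('a, 'b, 'x) trm =
    TExp "('a, 'b, 'x) expr"
  | TSlt 'b
  | TPair "('a, 'b, 'x) trm" "('a, 'b, 'x) trm"
  | TK1 "('a, 'b, 'x) trm"
  | TK2 "('a, 'b, 'x) trm"
  | TBot
  | TTop
  | TFun "'a \<Rightarrow> ('a, 'b, 'x) trm option"
  | TSet "('a, 'b, 'x) trm fset"
  | TDelta "('a, 'b) ndf" "('a, 'b, 'x) expr"
  | TEmpty "('a, 'b) ndf"
  | TPlus "('a, 'b) ndf" "('a, 'b, 'x) trm" "('a, 'b, 'x) trm"

text \<open>Ground terms of sort \<open>Bool\<close>; \<open>BSim\<close> is the operator \<open>\<simeq>\<close>.\<close>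

datatype ('a, 'b, 'x) btrm =
    BTrue
  | BFalse
  | BSim "('a, 'b, 'x) trm" "('a, 'b, 'x) trm"

text \<open>
  Ground instances of the equations. The equations defining \<open>\<delta>\<close> are conditional on the typing of
  their left-hand sides.
\<close>

inductive axE :: "('a, 'b) ndf \<Rightarrow> ('a, 'b, 'x) trm \<Rightarrow> ('a, 'b, 'x) trm \<Rightarrow> bool"
  for G :: "('a, 'b) ndf" where
  empty_id: "axE G (TEmpty FId) (TExp EZero)"
| empty_const: "axE G (TEmpty (FConst B)) (TSlt (jbot B))"
| empty_prod: "axE G (TEmpty (FProd F1 F2)) (TPair (TEmpty F1) (TEmpty F2))"
| empty_sum: "axE G (TEmpty (FSum F1 F2)) TBot"
| empty_exp: "axE G (TEmpty (FExp F A)) (TFun (\<lambda>a. if a |\<in>| A then Some (TEmpty F) else None))"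
| empty_pow: "axE G (TEmpty (FPow F)) (TSet {||})"
| plus_id: "axE G (TPlus FId (TExp e) (TExp d)) (TExp (EPlus e d))"
| plus_const: "b |\<in>| jcarrier B \<Longrightarrow> c |\<in>| jcarrier B \<Longrightarrow>
    axE G (TPlus (FConst B) (TSlt b) (TSlt c)) (TSlt (jjoin B b c))"
| plus_prod: "axE G (TPlus (FProd F1 F2) (TPair s1 s2) (TPair t1 t2))
    (TPair (TPlus F1 s1 t1) (TPlus F2 s2 t2))"
| plus_sum11: "axE G (TPlus (FSum F1 F2) (TK1 s) (TK1 t)) (TK1 (TPlus F1 s t))"
| plus_sum22: "axE G (TPlus (FSum F1 F2) (TK2 s) (TK2 t)) (TK2 (TPlus F2 s t))"
| plus_sum12: "axE G (TPlus (FSum F1 F2) (TK1 s) (TK2 t)) TTop"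
| plus_sum21: "axE G (TPlus (FSum F1 F2) (TK2 s) (TK1 t)) TTop"
| plus_sum_topR: "axE G (TPlus (FSum F1 F2) s TTop) TTop"
| plus_sum_topL: "axE G (TPlus (FSum F1 F2) TTop t) TTop"
| plus_sum_botR: "axE G (TPlus (FSum F1 F2) s TBot) s"
| plus_sum_botL: "axE G (TPlus (FSum F1 F2) TBot t) t"
| plus_exp: "dom f = fset A \<Longrightarrow> dom g = fset A \<Longrightarrow>
    axE G (TPlus (FExp F A) (TFun f) (TFun g))
      (TFun (\<lambda>a. if a |\<in>| A then Some (TPlus F (the (f a)) (the (g a))) else None))"
| plus_pow: "axE G (TPlus (FPow F) (TSet S) (TSet T)) (TSet (S |\<union>| T))"
| delta_zero: "EZero \<in> (Exps G F :: ('a, 'b, 'x) expr set) \<Longrightarrow> axE G (TDelta F EZero) (TEmpty F)"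
| delta_plus: "EPlus e d \<in> Exps G F \<Longrightarrow>
    axE G (TDelta F (EPlus e d)) (TPlus F (TDelta F e) (TDelta F d))"
| delta_mu: "EMu x e \<in> Exps G G \<Longrightarrow> axE G (TDelta G (EMu x e)) (TDelta G (subst x (EMu x e) e))"
| delta_id: "e \<in> Exps G FId \<Longrightarrow> G \<noteq> FId \<Longrightarrow> axE G (TDelta FId e) (TExp e)"
| delta_const: "ESlt b \<in> (Exps G (FConst B) :: ('a, 'b, 'x) expr set) \<Longrightarrow>
    axE G (TDelta (FConst B) (ESlt b)) (TSlt b)"
| delta_prodL: "EProdL e \<in> Exps G (FProd F1 F2) \<Longrightarrow>
    axE G (TDelta (FProd F1 F2) (EProdL e)) (TPair (TDelta F1 e) (TEmpty F2))"
| delta_prodR: "EProdR e \<in> Exps G (FProd F1 F2) \<Longrightarrow>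
    axE G (TDelta (FProd F1 F2) (EProdR e)) (TPair (TEmpty F1) (TDelta F2 e))"
| delta_sumL: "ESumL e \<in> Exps G (FSum F1 F2) \<Longrightarrow>
    axE G (TDelta (FSum F1 F2) (ESumL e)) (TK1 (TDelta F1 e))"
| delta_sumR: "ESumR e \<in> Exps G (FSum F1 F2) \<Longrightarrow>
    axE G (TDelta (FSum F1 F2) (ESumR e)) (TK2 (TDelta F2 e))"
| delta_act: "EAct a e \<in> Exps G (FExp F A) \<Longrightarrow>
    axE G (TDelta (FExp F A) (EAct a e))
      (TFun (\<lambda>a'. if a' |\<in>| A then Some (if a' = a then TDelta F e else TEmpty F) else None))"
| delta_sing: "ESing e \<in> Exps G (FPow F) \<Longrightarrow>
    axE G (TDelta (FPow F) (ESing e)) (TSet {|TDelta F e|})"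

text \<open>
  Equational entailment \<open>\<E>\<^bsub>G\<^esub> \<turnstile> s = t\<close> on the sort \<open>ExpStruct\<close>: the congruence generated by \<open>axE\<close>.
\<close>

inductive eqE :: "('a, 'b) ndf \<Rightarrow> ('a, 'b, 'x) trm \<Rightarrow> ('a, 'b, 'x) trm \<Rightarrow> bool"
  for G :: "('a, 'b) ndf" where
  eqE_ax: "axE G s t \<Longrightarrow> eqE G s t"
| eqE_refl: "eqE G s s"
| eqE_sym: "eqE G s t \<Longrightarrow> eqE G t s"
| eqE_trans: "eqE G s t \<Longrightarrow> eqE G t u \<Longrightarrow> eqE G s u"
| eqE_EPlus: "eqE G (TExp e) (TExp e') \<Longrightarrow> eqE G (TExp d) (TExp d') \<Longrightarrow>
    eqE G (TExp (EPlus e d)) (TExp (EPlus e' d'))"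
| eqE_EMu: "eqE G (TExp e) (TExp e') \<Longrightarrow> eqE G (TExp (EMu x e)) (TExp (EMu x e'))"
| eqE_EProdL: "eqE G (TExp e) (TExp e') \<Longrightarrow> eqE G (TExp (EProdL e)) (TExp (EProdL e'))"
| eqE_EProdR: "eqE G (TExp e) (TExp e') \<Longrightarrow> eqE G (TExp (EProdR e)) (TExp (EProdR e'))"
| eqE_ESumL: "eqE G (TExp e) (TExp e') \<Longrightarrow> eqE G (TExp (ESumL e)) (TExp (ESumL e'))"
| eqE_ESumR: "eqE G (TExp e) (TExp e') \<Longrightarrow> eqE G (TExp (ESumR e)) (TExp (ESumR e'))"
| eqE_EAct: "eqE G (TExp e) (TExp e') \<Longrightarrow> eqE G (TExp (EAct a e)) (TExp (EAct a e'))"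
| eqE_ESing: "eqE G (TExp e) (TExp e') \<Longrightarrow> eqE G (TExp (ESing e)) (TExp (ESing e'))"
| eqE_TDelta: "eqE G (TExp e) (TExp e') \<Longrightarrow> eqE G (TDelta F e) (TDelta F e')"
| eqE_TPair: "eqE G s s' \<Longrightarrow> eqE G t t' \<Longrightarrow> eqE G (TPair s t) (TPair s' t')"
| eqE_TK1: "eqE G s t \<Longrightarrow> eqE G (TK1 s) (TK1 t)"
| eqE_TK2: "eqE G s t \<Longrightarrow> eqE G (TK2 s) (TK2 t)"
| eqE_TFun: "dom f = dom g \<Longrightarrow> (\<And>a s t. f a = Some s \<Longrightarrow> g a = Some t \<Longrightarrow> eqE G s t) \<Longrightarrow>
    eqE G (TFun f) (TFun g)"
| eqE_TSet: "(\<And>s. s |\<in>| S \<Longrightarrow> \<exists>t. t |\<in>| T \<and> eqE G s t) \<Longrightarrow>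
    (\<And>t. t |\<in>| T \<Longrightarrow> \<exists>s. s |\<in>| S \<and> eqE G s t) \<Longrightarrow> eqE G (TSet S) (TSet T)"
| eqE_TPlus: "eqE G s s' \<Longrightarrow> eqE G t t' \<Longrightarrow> eqE G (TPlus F s t) (TPlus F s' t')"

inductive eqB :: "('a, 'b) ndf \<Rightarrow> ('a, 'b, 'x) btrm \<Rightarrow> ('a, 'b, 'x) btrm \<Rightarrow> bool"
  for G :: "('a, 'b) ndf" where
  eqB_true: "eqB G (BSim (TSlt b) (TSlt b)) BTrue"
| eqB_false: "b \<noteq> c \<Longrightarrow> eqB G (BSim (TSlt b) (TSlt c)) BFalse"
| eqB_refl: "eqB G p p"
| eqB_sym: "eqB G p q \<Longrightarrow> eqB G q p"
| eqB_trans: "eqB G p q \<Longrightarrow> eqB G q r \<Longrightarrow> eqB G p r"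
| eqB_BSim: "eqE G s s' \<Longrightarrow> eqE G t t' \<Longrightarrow> eqB G (BSim s t) (BSim s' t')"


section \<open>Frozen equations and the extended entailment\<close>

datatype ('a, 'b, 'x) equation =
    EqS "('a, 'b, 'x) trm" "('a, 'b, 'x) trm"
  | EqB "('a, 'b, 'x) btrm" "('a, 'b, 'x) btrm"

text \<open>
  The sort \<open>Frozen\<close>, with one freezing operator for each of the two sorts above. No operator takes
  an argument of sort \<open>Frozen\<close>, so there is no congruence rule for frozen hypotheses.
\<close>

datatype ('a, 'b, 'x) frozen = FrzS "('a, 'b, 'x) trm" | FrzB "('a, 'b, 'x) btrm"

type_synonym ('a, 'b, 'x) feq = "('a, 'b, 'x) frozen \<times> ('a, 'b, 'x) frozen"

primrec freeze :: "('a, 'b, 'x) equation \<Rightarrow> ('a, 'b, 'x) feq" where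
  "freeze (EqS s t) = (FrzS s, FrzS t)"
| "freeze (EqB p q) = (FrzB p, FrzB q)"

text \<open>
  \<open>interpolant e Es\<close>: the equation \<open>e\<close> may be replaced by the equations \<open>Es\<close>. An instance of the
  disjunctive interpolant for sets selects a set \<open>K\<close> of pairs that matches every \<open>\<sigma>\<^sub>i\<close> with some
  \<open>\<sigma>'\<^sub>j\<close> and every \<open>\<sigma>'\<^sub>j\<close> with some \<open>\<sigma>\<^sub>i\<close>.
\<close>

inductive interpolant :: "('a, 'b, 'x) equation \<Rightarrow> ('a, 'b, 'x) equation set \<Rightarrow> bool" where
  int_pair: "interpolant (EqS (TPair s t) (TPair s' t')) {EqS s s', EqS t t'}"
| int_k1: "interpolant (EqS (TK1 s) (TK1 t)) {EqS s t}"
| int_k2: "interpolant (EqS (TK2 s) (TK2 t)) {EqS s t}"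
| int_fun: "dom f = dom g \<Longrightarrow>
    interpolant (EqS (TFun f) (TFun g)) {EqS (the (f a)) (the (g a)) | a. a \<in> dom f}"
| int_set: "K \<subseteq> fset S \<times> fset T \<Longrightarrow> fst ` K = fset S \<Longrightarrow> snd ` K = fset T \<Longrightarrow>
    interpolant (EqS (TSet S) (TSet T)) {EqS s t | s t. (s, t) \<in> K}"
| int_slt: "interpolant (EqS (TSlt b) (TSlt c)) {EqB (BSim (TSlt b) (TSlt c)) BTrue}"

text \<open>
  \<open>ndf_entails G H (p, q)\<close> is \<open>\<E>\<^bsub>G\<^esub> \<union> H \<turnstile>\<^bsub>NDF\<^esub> p = q\<close> for a set \<open>H\<close> of frozen equations. A frozen
  equality of two sets decomposes into a disjunction (some \<open>\<sigma>'\<^sub>j\<close> is equal to \<open>\<sigma>\<^sub>i\<close>), so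
  \<open>ent_dec_set\<close> is stated as reasoning by cases; the symmetric decomposition follows with \<open>ent_sym\<close>.
\<close>

inductive ndf_entails :: "('a, 'b) ndf \<Rightarrow> ('a, 'b, 'x) feq set \<Rightarrow> ('a, 'b, 'x) feq \<Rightarrow> bool"
  for G :: "('a, 'b) ndf" where
  ent_hyp: "q \<in> H \<Longrightarrow> ndf_entails G H q"
| ent_eqE: "eqE G s t \<Longrightarrow> ndf_entails G H (FrzS s, FrzS t)"
| ent_eqB: "eqB G s t \<Longrightarrow> ndf_entails G H (FrzB s, FrzB t)"
| ent_sym: "ndf_entails G H (p, q) \<Longrightarrow> ndf_entails G H (q, p)"
| ent_trans: "ndf_entails G H (p, q) \<Longrightarrow> ndf_entails G H (q, r) \<Longrightarrow> ndf_entails G H (p, r)"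
| ent_dec_pair1: "ndf_entails G H (FrzS (TPair s t), FrzS (TPair s' t')) \<Longrightarrow>
    ndf_entails G H (FrzS s, FrzS s')"
| ent_dec_pair2: "ndf_entails G H (FrzS (TPair s t), FrzS (TPair s' t')) \<Longrightarrow>
    ndf_entails G H (FrzS t, FrzS t')"
| ent_dec_k1: "ndf_entails G H (FrzS (TK1 s), FrzS (TK1 t)) \<Longrightarrow> ndf_entails G H (FrzS s, FrzS t)"
| ent_dec_k2: "ndf_entails G H (FrzS (TK2 s), FrzS (TK2 t)) \<Longrightarrow> ndf_entails G H (FrzS s, FrzS t)"
| ent_dec_fun: "ndf_entails G H (FrzS (TFun f), FrzS (TFun g)) \<Longrightarrow>
    f a = Some s \<Longrightarrow> g a = Some t \<Longrightarrow> ndf_entails G H (FrzS s, FrzS t)"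
| ent_dec_set: "ndf_entails G H (FrzS (TSet S), FrzS (TSet T)) \<Longrightarrow> s |\<in>| S \<Longrightarrow>
    (\<And>t. t |\<in>| T \<Longrightarrow> ndf_entails G (insert (FrzS s, FrzS t) H) q) \<Longrightarrow> ndf_entails G H q"
| ent_interpolant: "interpolant e Es \<Longrightarrow> (\<And>e'. e' \<in> Es \<Longrightarrow> ndf_entails G H (freeze e')) \<Longrightarrow>
    ndf_entails G H (freeze e)"


section \<open>The reduction rules of CIRC\<close>

inductive eqn_modE :: "('a, 'b) ndf \<Rightarrow> ('a, 'b, 'x) equation \<Rightarrow> ('a, 'b, 'x) equation \<Rightarrow> bool"
  for G :: "('a, 'b) ndf" where
  "eqE G s s' \<Longrightarrow> eqE G t t' \<Longrightarrow> eqn_modE G (EqS s t) (EqS s' t')"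
| "eqB G p p' \<Longrightarrow> eqB G q q' \<Longrightarrow> eqn_modE G (EqB p q) (EqB p' q')"

text \<open>
  One step on the hypotheses and the goals; the theory \<open>\<B>\<^bsub>G\<^esub>\<close>, which no step changes, is determined
  by the parameter \<open>G\<close>. Goals are taken modulo \<open>\<E>\<^bsub>G\<^esub>\<close>: the term \<open>\<delta>\<^bsub>G \<triangleleft> G\<^esub>(e)\<close> itself has no pair,
  injection, function or set at the root, so an interpolant applies to it only after \<open>\<delta>\<close> has been
  evaluated. A goal is derivable if it is an equation between expressions.
\<close>

inductive circ_step ::
    "('a, 'b) ndf \<Rightarrow> ('a, 'b, 'x) feq set \<times> ('a, 'b, 'x) feq set \<Rightarrow>
      ('a, 'b, 'x) feq set \<times> ('a, 'b, 'x) feq set \<Rightarrow> bool"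
  for G :: "('a, 'b) ndf" where
  circ_reduce: "ndf_entails G Hyps q \<Longrightarrow> circ_step G (Hyps, insert q Goals) (Hyps, Goals)"
| circ_derive: "\<not> ndf_entails G Hyps (freeze g) \<Longrightarrow> eqn_modE G g (EqS (TExp e) (TExp d)) \<Longrightarrow>
    circ_step G (Hyps, insert (freeze g) Goals)
      (insert (freeze (EqS (TExp e) (TExp d))) Hyps,
       insert (freeze (EqS (TDelta G e) (TDelta G d))) Goals)"
| circ_simplify: "interpolant e Es \<Longrightarrow> eqn_modE G g e \<Longrightarrow>
    circ_step G (Hyps, insert (freeze g) Goals) (Hyps, freeze ` Es \<union> Goals)"

definition frozen_rel ::
    "(('a, 'b, 'x) expr \<times> ('a, 'b, 'x) expr) set \<Rightarrow> ('a, 'b, 'x) feq set" where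
  "frozen_rel R = {freeze (EqS (TExp e) (TExp d)) | e d. (e, d) \<in> R}"

end

theory Submission
  imports Defs
begin

text \<open>
  Ground terms are evaluated in the coalgebra of expressions, and a frozen equation is read as
  relatedness of the values under the relation lifting of a relation \<open>R\<close> on expressions. If \<open>R\<close> is
  an equivalence that contains all hypotheses, then entailment is sound for this reading. Take for
  \<open>R\<close> the equivalence generated by the final hypotheses. Reading the reduction backwards from the
  empty set of goals, every goal that ever occurs holds. Among these goals are the derivatives of
  all hypotheses, so \<open>R\<close>, restricted to well-typed expressions, is a bisimulation.
\<close>

section \<open>Evaluation of ground terms and soundness of the equations\<close>

primrec trm_val :: "('a, 'b) ndf \<Rightarrow> ('a, 'b, 'x) trm \<Rightarrow> ('a, 'b, 'x) eval" where
  "trm_val G (TExp e) = VId e"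
| "trm_val G (TSlt b) = VSlt b"
| "trm_val G (TPair s t) = VPair (trm_val G s) (trm_val G t)"
| "trm_val G (TK1 s) = VK1 (trm_val G s)"
| "trm_val G (TK2 s) = VK2 (trm_val G s)"
| "trm_val G TBot = VBot"
| "trm_val G TTop = VTop"
| "trm_val G (TFun f) = VFun (map_option (trm_val G) \<circ> f)"
| "trm_val G (TSet S) = VSet (trm_val G |`| S)"
| "trm_val G (TDelta F e) = delta G F e"
| "trm_val G (TEmpty F) = empty_val F"
| "trm_val G (TPlus F s t) = plus_val F (trm_val G s) (trm_val G t)"

text \<open>\<open>BSim\<close> is read as identity of values: interpolants produce it only on
  semilattice elements, where the lifting of any relation is the identity.\<close>

primrec btrm_val :: "('a, 'b) ndf \<Rightarrow> ('a, 'b, 'x) btrm \<Rightarrow> bool" where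
  "btrm_val G BTrue = True"
| "btrm_val G BFalse = False"
| "btrm_val G (BSim s t) = (trm_val G s = trm_val G t)"

lemma axE_sound: "axE G s t \<Longrightarrow> trm_val G s = trm_val G t"
proof (induction rule: axE.induct)
  case (plus_exp f A g F)
  then have "f a \<noteq> None" "g a \<noteq> None" if "a |\<in>| A" for a using that by blast+
  then show ?case by (simp add: fun_eq_iff option.map_sel)
next
  case (delta_zero F)
  then show ?case by (simp add: delta.simps)
next
  case (delta_plus e d F)
  \<comment> \<open>For \<open>F = FId\<close> and \<open>G\<close> different from it,
    \<open>delta\<close> wraps its argument without looking inside, and \<open>plus_val FId\<close>
    rebuilds the sum.\<close>
  then show ?case by (simp add: delta.simps[of G F "EPlus e d"]) (simp add: delta.simps)
next
  case (delta_mu x e)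
  \<comment> \<open>Membership in \<open>Exps\<close> gives the guardedness that
    \<open>delta\<close> tests before unfolding.\<close>
  then show ?case by (simp add: Exps_def delta.simps[of G G "EMu x e"])
qed (auto simp: delta.simps fun_eq_iff)

text \<open>Expressions are interpreted by themselves and \<open>VId\<close> is injective, so
  equated expressions coincide; this carries the congruence rules below the expression constructors
  and \<open>TDelta\<close>.\<close>

lemma eqE_sound: "eqE G s t \<Longrightarrow> trm_val G s = trm_val G t"
proof (induction rule: eqE.induct)
  case (eqE_ax s t)
  then show ?case by (rule axE_sound)
next
  case (eqE_TFun f g)
  have "map_option (trm_val G) (f a) = map_option (trm_val G) (g a)" for a
    using eqE_TFun(1,3) domIff[of a f] domIff[of a g] by (cases "f a"; cases "g a") auto
  then show ?case by (simp add: fun_eq_iff)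
next
  case (eqE_TSet S T)
  then have "trm_val G ` fset S \<subseteq> trm_val G ` fset T" "trm_val G ` fset T \<subseteq> trm_val G ` fset S"
    by (blast intro: image_eqI sym)+
  then have "trm_val G ` fset S = trm_val G ` fset T" by blast
  then have "trm_val G |`| S = trm_val G |`| T" by (simp flip: fset_inject)
  then show ?case by simp
qed auto

lemma eqB_sound: "eqB G p q \<Longrightarrow> btrm_val G p = btrm_val G q"
proof (induction rule: eqB.induct)
  case (eqB_BSim s s' t t')
  then show ?case using eqE_sound[of G s s'] eqE_sound[of G t t'] by simp
qed simp_all

section \<open>Soundness of the extended entailment\<close>

text \<open>The relator \<open>rel_val R\<close> serves as relation lifting with the functor left
  out; typing returns in \<open>rel_liftingI\<close>.\<close>

fun holds ::
    "('a, 'b) ndf \<Rightarrow> (('a, 'b, 'x) expr \<Rightarrow> ('a, 'b, 'x) expr \<Rightarrow> bool) \<Rightarrow> ('a, 'b, 'x) feq \<Rightarrow> bool"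
  where
  "holds G R (FrzS s, FrzS t) \<longleftrightarrow> rel_val R (trm_val G s) (trm_val G t)"
| "holds G R (FrzB p, FrzB q) \<longleftrightarrow> btrm_val G p = btrm_val G q"
| "holds G R _ \<longleftrightarrow> False"

lemma holds_refl: "reflp R \<Longrightarrow> holds G R (p, p)"
  by (cases p) (auto intro: val.rel_refl_strong reflpD)

lemma holds_sym: "symp R \<Longrightarrow> holds G R (p, q) \<Longrightarrow> holds G R (q, p)"
  by (cases p; cases q) (auto intro: sympD[OF val.rel_symp])

lemma holds_trans: "transp R \<Longrightarrow> holds G R (p, q) \<Longrightarrow> holds G R (q, r) \<Longrightarrow> holds G R (p, r)"
  by (cases p; cases q; cases r) (auto intro: transpD[OF val.rel_transp])

text \<open>The relator acts componentwise. For sets, the two projections of \<open>K\<close> supply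
  the partners that \<open>rel_fset\<close> asks for in both directions.\<close>

lemma interpolant_sound:
  assumes "interpolant e Es" and "\<And>e'. e' \<in> Es \<Longrightarrow> holds G R (freeze e')"
  shows "holds G R (freeze e)"
  using assms
proof (induction rule: interpolant.induct)
  case (int_pair s t s' t')
  then show ?case using int_pair[of "EqS s s'"] int_pair[of "EqS t t'"] by simp
next
  case (int_fun f g)
  have "rel_option (rel_val R) (map_option (trm_val G) (f a)) (map_option (trm_val G) (g a))" for a
  proof (cases "f a")
    case None
    then show ?thesis using int_fun(1) domIff[of a f] domIff[of a g] by auto
  next
    case (Some s)
    then obtain t where "g a = Some t" using int_fun(1) by (auto simp: dom_def set_eq_iff)
    then show ?thesis using Some int_fun(2)[of "EqS s t"] by force
  qed
  then show ?case by (simp add: rel_fun_def)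
next
  case (int_set K S T)
  have K: "s |\<in>| S" "t |\<in>| T" "rel_val R (trm_val G s) (trm_val G t)" if "(s, t) \<in> K" for s t
    using that int_set(1) int_set(4)[of "EqS s t"] by auto
  have "\<exists>t. (s, t) \<in> K" if "s |\<in>| S" for s using that int_set(2) by (force simp: set_eq_iff)
  moreover have "\<exists>s. (s, t) \<in> K" if "t |\<in>| T" for t using that int_set(3) by (force simp: set_eq_iff)
  ultimately have "rel_fset (rel_val R) (trm_val G |`| S) (trm_val G |`| T)"
    unfolding rel_fset_alt_def using K by (simp add: Ball_def Bex_def) blast
  then show ?case by simp
qed auto

lemma ndf_entails_sound:
  assumes "ndf_entails G H q" and "equivp R" and "\<And>h. h \<in> H \<Longrightarrow> holds G R h"
  shows "holds G R q"
  using assms(1,3)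
proof (induction rule: ndf_entails.induct)
  case (ent_hyp q H)
  then show ?case by blast
next
  case (ent_eqE s t H)
  then show ?case
    using holds_refl[of R G "FrzS t"] assms(2) by (auto dest!: eqE_sound simp: equivp_reflp_symp_transp)
next
  case (ent_eqB s t H)
  then show ?case by (auto dest: eqB_sound)
next
  case (ent_sym H p q)
  then show ?case using holds_sym assms(2) equivp_reflp_symp_transp by blast
next
  case (ent_trans H p q r)
  then show ?case using holds_trans assms(2) equivp_reflp_symp_transp by blast
next
  case (ent_dec_fun H f g a s t)
  then have "holds G R (FrzS (TFun f), FrzS (TFun g))" by blast
  then have "rel_option (rel_val R) (map_option (trm_val G) (f a)) (map_option (trm_val G) (g a))"
    by (simp add: rel_fun_def)
  with ent_dec_fun(2,3) show ?case by simp
next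
  case (ent_dec_set H S T s q)
  then have "rel_fset (rel_val R) (trm_val G |`| S) (trm_val G |`| T)" by simp
  then obtain t where t: "t |\<in>| T" "rel_val R (trm_val G s) (trm_val G t)"
    using ent_dec_set(2) unfolding rel_fset_alt_def by auto
  \<comment> \<open>One branch of the case distinction suffices: for this \<open>t\<close> the added
    hypothesis is true under \<open>R\<close>.\<close>
  show ?case
    by (rule ent_dec_set.IH(2)[OF t(1)]) (use t(2) ent_dec_set.prems in auto)
next
  case (ent_interpolant e Es H)
  then show ?case using interpolant_sound by blast
qed simp_all

lemma eqn_modE_sound: "eqn_modE G g e \<Longrightarrow> holds G R (freeze g) \<longleftrightarrow> holds G R (freeze e)"
proof (induction rule: eqn_modE.induct)
  case (1 s s' t t')
  then show ?case using eqE_sound[of G s s'] eqE_sound[of G t t'] by simp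
next
  case (2 p p' q q')
  then show ?case using eqB_sound[of G p p'] eqB_sound[of G q q'] by simp
qed

section \<open>Reductions read backwards\<close>

lemma circ_step_hyps: "circ_step G (H, Gs) (H', Gs') \<Longrightarrow> H \<subseteq> H'"
  by (auto elim: circ_step.cases)

lemma circ_step_goals:
  assumes "circ_step G (H, Gs) (H', Gs')" and "equivp R"
    and "\<And>h. h \<in> H' \<Longrightarrow> holds G R h" and "\<And>q. q \<in> Gs' \<Longrightarrow> holds G R q" and "q \<in> Gs"
  shows "holds G R q"
  using assms(1)
proof cases
  case (circ_reduce q')
  then show ?thesis using assms(2-5) ndf_entails_sound[of G H q' R] by blast
next
  case (circ_derive g e d Goals)
  \<comment> \<open>The discarded goal is, modulo the specification, the equation just stored as a
    hypothesis, and all hypotheses in \<open>H'\<close> hold.\<close>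
  then have "holds G R (freeze g)" using assms(3) eqn_modE_sound by blast
  then show ?thesis using assms(4,5) circ_derive by blast
next
  case (circ_simplify e Es g Goals)
  have "holds G R (freeze e)"
    by (rule interpolant_sound[OF circ_simplify(4)]) (use assms(4) circ_simplify(3) in blast)
  then have "holds G R (freeze g)" using eqn_modE_sound circ_simplify(5) by blast
  then show ?thesis using assms(4,5) circ_simplify by blast
qed

text \<open>Only \<open>circ_derive\<close> enlarges the hypotheses.\<close>

lemma circ_step_new_hyp:
  assumes "circ_step G (H, Gs) (H', Gs')" and "h \<in> H' - H"
  shows "\<exists>e d. h = freeze (EqS (TExp e) (TExp d)) \<and> freeze (EqS (TDelta G e) (TDelta G d)) \<in> Gs'"
  using assms by cases auto

lemma circ_steps_hyps: "(circ_step G)\<^sup>*\<^sup>* (H, Gs) (H', Gs') \<Longrightarrow> H \<subseteq> H'"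
  by (induction rule: rtranclp_induct2) (use circ_step_hyps in blast)+

text \<open>The derivative of each added hypothesis is a goal of the next state, so the induction
  that makes all goals hold also yields the second conjunct.\<close>

lemma circ_steps_sound:
  assumes "(circ_step G)\<^sup>*\<^sup>* (H, Gs) (Hn, {})" and "equivp R" and "\<And>h. h \<in> Hn \<Longrightarrow> holds G R h"
  shows "(\<forall>q \<in> Gs. holds G R q) \<and>
    (\<forall>h \<in> Hn - H. \<exists>e d. h = freeze (EqS (TExp e) (TExp d)) \<and> rel_val R (delta G G e) (delta G G d))"
  using assms(1)
proof (induction rule: converse_rtranclp_induct2)
  case refl
  then show ?case by simp
next
  case (step H Gs H' Gs')
  have "H' \<subseteq> Hn" using step(2) by (rule circ_steps_hyps)
  then have hyps: "\<And>h. h \<in> H' \<Longrightarrow> holds G R h" using assms(3) by blast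
  have new: "\<exists>e d. h = freeze (EqS (TExp e) (TExp d)) \<and> rel_val R (delta G G e) (delta G G d)"
    if "h \<in> H' - H" for h
    using circ_step_new_hyp[OF step(1) that] step(3) by force
  show ?case
    using circ_step_goals[OF step(1) assms(2) hyps] step(3) new by blast
qed

section \<open>From the relator to bisimulations\<close>

text \<open>Membership in \<open>functor_obj\<close> fixes a shape, which \<open>map_val h\<close>
  preserves, and a condition on the entries.\<close>

lemma functor_obj_map_val:
  "map_val h z \<in> functor_obj F X \<Longrightarrow> set_val z \<subseteq> Y \<Longrightarrow> z \<in> functor_obj F Y"
proof (induction F arbitrary: z)
  case (FExp F A)
  then obtain f where z: "z = VFun f" by (cases z) auto
  have "s \<in> functor_obj F Y" if "f a = Some s" for a s
    using FExp z that by (intro FExp.IH) (fastforce simp: ran_def)+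
  then show ?case using FExp.prems z by (auto simp: ran_def dom_def)
next
  case (FPow F)
  then show ?case by (cases z) fastforce+
qed (case_tac z; force)+

text \<open>The relator yields a value \<open>z\<close> of pairs projecting to \<open>u\<close> and
  \<open>v\<close>; \<open>z\<close> takes its shape from \<open>u\<close>, and its entries lie in
  \<open>X\<close> on both sides.\<close>

lemma rel_liftingI:
  assumes "rel_val R u v" and "u \<in> functor_obj F X" and "v \<in> functor_obj F X"
  shows "(u, v) \<in> rel_lifting F {(x, y). R x y \<and> x \<in> X \<and> y \<in> X}"
proof -
  have set_val: "set_val w \<subseteq> X" if "w \<in> functor_obj F X" for w
    using that
  proof (induction F arbitrary: w)
    case (FExp F A)
    then show ?case by (fastforce simp: ran_def)
  qed fastforce+
  obtain z where z: "set_val z \<subseteq> {(x, y). R x y}" "map_val fst z = u" "map_val snd z = v"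
    using assms(1) by (auto simp: val.in_rel)
  then have "fst ` set_val z \<subseteq> X" "snd ` set_val z \<subseteq> X"
    using set_val assms(2,3) by (auto simp flip: val.set_map)
  then have "set_val z \<subseteq> {(x, y). R x y \<and> x \<in> X \<and> y \<in> X}" using z(1) by auto
  moreover have "map_val fst z \<in> functor_obj F X" using z(2) assms(2) by simp
  ultimately show ?thesis
    using z(2,3) functor_obj_map_val by (fastforce simp: rel_lifting_def)
qed

lemma is_bisimulationI:
  assumes "nondet_functor G" and "\<And>e d. R e d \<Longrightarrow> rel_val R (delta G G e) (delta G G d)"
  shows "is_bisimulation G {(e, d). R e d \<and> e \<in> Exps G G \<and> d \<in> Exps G G}"
  unfolding is_bisimulation_def
  using assms by (auto intro!: rel_liftingI delta_in_functor_obj)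

theorem theorem3:
  fixes G :: "('a, 'b) ndf"
    and \<G> :: "(('a, 'b, 'x) expr \<times> ('a, 'b, 'x) expr) set"
    and \<F>\<^sub>n :: "('a, 'b, 'x) feq set"
  assumes "nondet_functor G"
    and "\<G> \<subseteq> Exps G G \<times> Exps G G"
    and "(circ_step G)\<^sup>*\<^sup>* ({}, frozen_rel \<G>) (\<F>\<^sub>n, {})"
  shows "\<G> \<subseteq> bisimilarity G"
proof -
  define P where "P e d \<longleftrightarrow> freeze (EqS (TExp e) (TExp d)) \<in> \<F>\<^sub>n" for e d
  define R where "R = equivclp P"
  have R: "equivp R" unfolding R_def by (rule equivp_evquivclp)
  \<comment> \<open>The reduction starts without hypotheses, so each one was put there by
    \<open>circ_derive\<close>.\<close>
  have shape: "\<exists>e d. h = freeze (EqS (TExp e) (TExp d))" if "h \<in> \<F>\<^sub>n" for h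
  proof -
    have "\<forall>h \<in> H. \<exists>e d. h = freeze (EqS (TExp e) (TExp d))"
      if "(circ_step G)\<^sup>*\<^sup>* ({}, frozen_rel \<G>) (H, Gs)" for H Gs
      using that
    proof (induction rule: rtranclp_induct2)
      case (step H Gs H' Gs')
      then show ?case using circ_step_new_hyp by blast
    qed simp
    then show ?thesis using assms(3) that by blast
  qed
  have hyps: "holds G R h" if h: "h \<in> \<F>\<^sub>n" for h
  proof -
    obtain e d where "h = freeze (EqS (TExp e) (TExp d))" using shape[OF h] by blast
    then show ?thesis using h by (auto simp: R_def P_def)
  qed
  note sound = circ_steps_sound[OF assms(3) R hyps]
  \<comment> \<open>\<open>rel_val R\<close> is again an equivalence, so it suffices to relate the
    derivatives of generating pairs.\<close>
  have delta: "rel_val R (delta G G e) (delta G G d)" if "R e d" for e d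
    using that unfolding R_def
  proof (induction rule: equivclp_induct)
    case base
    then show ?case by (simp add: val.rel_refl)
  next
    case (step d d')
    have "rel_val R (delta G G x) (delta G G y)" if "P x y" for x y
      using that sound by (auto simp: P_def)
    then have "rel_val R (delta G G d) (delta G G d')"
      using step(2) sympD[OF val.rel_symp] R equivp_reflp_symp_transp by metis
    then show ?case
      using step(3) transpD[OF val.rel_transp] R equivp_reflp_symp_transp unfolding R_def by metis
  qed
  have "R e d" if "(e, d) \<in> \<G>" for e d
  proof -
    have "freeze (EqS (TExp e) (TExp d)) \<in> frozen_rel \<G>" using that by (auto simp: frozen_rel_def)
    then show ?thesis using sound by fastforce
  qed
  then have "\<G> \<subseteq> {(e, d). R e d \<and> e \<in> Exps G G \<and> d \<in> Exps G G}" using assms(2) by auto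
  then show ?thesis
    unfolding bisimilarity_def using is_bisimulationI[OF assms(1) delta] by auto
qed

end
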